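(* Let $\Omega$ be a convex quadrilateral with vertices $\mathbf{v}_1,\mathbf{v}_2,\mathbf{v}_3,\mathbf{v}_4$, let $\{\lambda_i\}_{i=1}^4$ be barycentric coordinates on $\Omega$, and let $\{\xi_{ij}\}_{ij\in V\cup E}$ be the functions $\xi_{ij}=\sum_{ab\in I}c^{ij}_{ab}\lambda_a\lambda_b$ constructed with the quadrilateral coefficients described in the context. Then for all $\mathbf{x}\in\Omega$: (1) $\sum_{ii\in V}\xi_{ii}+\sum_{i(i+1)\in E}2\xi_{i(i+1)}=1$; (2) $\sum_{ii\in V}\mathbf{v}_{ii}\xi_{ii}+\sum_{i(i+1)\in E}2\mathbf{v}_{i(i+1)}\xi_{i(i+1)}=\mathbf{x}$; (3) $\sum_{ii\in V}\mathbf{v}_i\mathbf{v}_i^T\xi_{ii}+\sum_{i(i+1)\in E}(\mathbf{v}_i\mathbf{v}_{i+1}^T+\mathbf{v}_{i+1}\mathbf{v}_i^T)\xi_{i(i+1)}=\mathbf{x}\mathbf{x}^T$.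
   Context: Vertices are ordered counter-clockwise and viewed as column vectors in $\mathbb{R}^2$; indices are taken modulo $n=4$; each interior angle is strictly less than $\pi$. Barycentric coordinates on $\Omega$ are functions $\lambda_i:\Omega\to\mathbb{R}$, $i=1,\dots,n$, with $\lambda_i\ge 0$ on $\Omega$ and $L=\sum_{i} L(\mathbf{v}_i)\lambda_i$ on $\Omega$ for every linear (i.e. affine, degree at most one) function $L:\Omega\to\mathbb{R}$. Index sets: $I=\{\{a,b\}: a,b\in\{1,\dots,4\}\}$ is the set of unordered, possibly non-distinct pairs; $V=\{11,22,33,44\}$, $E=\{12,23,34,14\}$, $D=\{13,24\}$, where $ab$ denotes $\{a,b\}$. $\mathbf{v}_{ab}:=(\mathbf{v}_a+\mathbf{v}_b)/2$ (so $\mathbf{v}_{aa}=\mathbf{v}_a$). Coefficients. For $ab\in V\cup E$: $c^{ij}_{ab}=1$ if $ij=ab$ and $c^{ij}_{ab}=0$ otherwise ($ij\in V\cup E$). For $ab=13$: apply a rigid motion (rotation and translation) of the plane so that $\mathbf{v}_1=(-\ell,0)$ and $\mathbf{v}_3=(\ell,0)$ with $\ell>0$, so that $\mathbf{v}_2$ is below the $x$-axis and $\mathbf{v}_4$ is above it. In these coordinates (subscripts $x,y$ denote components) set $$c^{22}_{13}=c^{44}_{13}=0,\qquad c^{12}_{13}=c^{23}_{13}=\frac{(\mathbf{v}_4)_y}{(\mathbf{v}_4)_y-(\mathbf{v}_2)_y},\qquad c^{34}_{13}=c^{14}_{13}=\frac{(\mathbf{v}_2)_y}{(\mathbf{v}_2)_y-(\mathbf{v}_4)_y},$$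 $$c^{11}_{13}=\frac{c^{12}_{13}(\mathbf{v}_2)_x+c^{34}_{13}(\mathbf{v}_4)_x}{\ell}-1,\qquad c^{33}_{13}=-\frac{c^{12}_{13}(\mathbf{v}_2)_x+c^{34}_{13}(\mathbf{v}_4)_x}{\ell}-1.$$ The coefficients $c^{ij}_{24}$ are defined by the same construction after the cyclic relabeling $1\to2\to3\to4\to1$ of the vertices (with its own rigid motion placing $\mathbf{v}_2$ and $\mathbf{v}_4$ on the $x$-axis). *)

theory Defs
  imports "HOL-Analysis.Analysis" "HOL-Library.Uprod"
begin

text \<open>
  Vertex indices have the type \<^typ>\<open>4\<close>, on which addition is addition modulo 4 and where
  \<open>4 = 0\<close>. Index pairs \<open>ab = {a, b}\<close>, possibly with \<open>a = b\<close>, are elements \<open>Upair a b\<close> of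
  the library's type of unordered pairs.
\<close>

definition I_pairs :: "4 uprod set" where
  "I_pairs = {Upair a b | a b. True}"

definition V_pairs :: "4 uprod set" where
  "V_pairs = {Upair 1 1, Upair 2 2, Upair 3 3, Upair 4 4}"

definition E_pairs :: "4 uprod set" where
  "E_pairs = {Upair 1 2, Upair 2 3, Upair 3 4, Upair 1 4}"

text \<open>
  The determinant is positive iff \<open>v j\<close> lies strictly to the left of the directed line from
  \<open>v i\<close> to \<open>v (i + 1)\<close>. For \<open>j = i + 2\<close> this says that the boundary turns strictly left at
  \<open>v (i + 1)\<close>: the order is counter-clockwise and the interior angle there is less than \<open>\<pi>\<close>.
\<close>

definition convex_quadrilateral :: "(real^2) set \<Rightarrow> (4 \<Rightarrow> real^2) \<Rightarrow> bool" where
  "convex_quadrilateral \<Omega> v \<longleftrightarrow>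
     \<Omega> = convex hull (range v) \<and>
     (\<forall>i j. j \<noteq> i \<and> j \<noteq> i + 1 \<longrightarrow>
        det (vector [v (i + 1) - v i, v j - v i] :: real^2^2) > 0)"

definition degree_le_1 :: "(real^2 \<Rightarrow> real) \<Rightarrow> bool" where
  "degree_le_1 L \<longleftrightarrow> (\<exists>f c. linear f \<and> L = (\<lambda>x. f x + c))"

text \<open>
  Functions on \<open>\<Omega>\<close> are represented by total functions of which only the values on \<open>\<Omega>\<close> matter;
  every function on \<open>\<Omega>\<close> of degree at most one is the restriction of one on the whole plane.
\<close>

definition barycentric_coordinates ::
  "(real^2) set \<Rightarrow> (4 \<Rightarrow> real^2) \<Rightarrow> (4 \<Rightarrow> real^2 \<Rightarrow> real) \<Rightarrow> bool" where
  "barycentric_coordinates \<Omega> v lam \<longleftrightarrow>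
     (\<forall>i. \<forall>x\<in>\<Omega>. lam i x \<ge> 0) \<and>
     (\<forall>L. degree_le_1 L \<longrightarrow> (\<forall>x\<in>\<Omega>. L x = (\<Sum>i\<in>UNIV. L (v i) * lam i x)))"

definition rigid_motion :: "(real^2 \<Rightarrow> real^2) \<Rightarrow> bool" where
  "rigid_motion \<phi> \<longleftrightarrow> (\<exists>A t. rotation_matrix A \<and> \<phi> = (\<lambda>x. A *v x + t))"

definition places_13 :: "(4 \<Rightarrow> real^2) \<Rightarrow> (real^2 \<Rightarrow> real^2) \<Rightarrow> bool" where
  "places_13 v \<phi> \<longleftrightarrow>
     rigid_motion \<phi> \<and>
     (\<exists>l>0. \<phi> (v 1) = vector [- l, 0] \<and> \<phi> (v 3) = vector [l, 0]) \<and>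
     \<phi> (v 2) $ 2 < 0 \<and> \<phi> (v 4) $ 2 > 0"

text \<open>
  The motion is unique for the vertices of a convex quadrilateral. In the coefficients
  \<open>c\<^sup>i\<^sup>j\<^sub>1\<^sub>3\<close> below, \<open>w k\<close> is the vertex \<open>v k\<close> after the motion and \<open>l\<close> is half the length of the
  diagonal. The value \<open>0\<close> for \<open>ij\<close> outside \<^const>\<open>V_pairs\<close> and \<^const>\<open>E_pairs\<close> is a dummy.
\<close>

definition coeff_13 :: "(4 \<Rightarrow> real^2) \<Rightarrow> 4 uprod \<Rightarrow> real" where
  "coeff_13 v ij =
     (let \<phi> = (SOME \<phi>. places_13 v \<phi>);
          w = (\<lambda>k. \<phi> (v k));
          l = w 3 $ 1;
          c12 = w 4 $ 2 / (w 4 $ 2 - w 2 $ 2);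
          c34 = w 2 $ 2 / (w 2 $ 2 - w 4 $ 2)
      in if ij \<in> {Upair 2 2, Upair 4 4} then 0
         else if ij \<in> {Upair 1 2, Upair 2 3} then c12
         else if ij \<in> {Upair 3 4, Upair 1 4} then c34
         else if ij = Upair 1 1 then (c12 * w 2 $ 1 + c34 * w 4 $ 1) / l - 1
         else if ij = Upair 3 3 then - ((c12 * w 2 $ 1 + c34 * w 4 $ 1) / l) - 1
         else 0)"

text \<open>
  The relabeling \<open>\<sigma> i = i + 1\<close> turns the vertices into \<open>v \<circ> \<sigma>\<close> and the pair \<open>13\<close> into \<open>24\<close>;
  hence the upper index of \<open>c\<^sup>i\<^sup>j\<^sub>2\<^sub>4\<close> is pulled back along \<open>\<sigma>\<close>.
\<close>

definition coeff_24 :: "(4 \<Rightarrow> real^2) \<Rightarrow> 4 uprod \<Rightarrow> real" where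
  "coeff_24 v ij = coeff_13 (\<lambda>i. v (i + 1)) (map_uprod (\<lambda>i. i - 1) ij)"

definition quad_coeff :: "(4 \<Rightarrow> real^2) \<Rightarrow> 4 uprod \<Rightarrow> 4 uprod \<Rightarrow> real" where
  "quad_coeff v ij ab =
     (if ab \<in> V_pairs \<union> E_pairs then (if ij = ab then 1 else 0)
      else if ab = Upair 1 3 then coeff_13 v ij
      else if ab = Upair 2 4 then coeff_24 v ij
      else 0)"

lift_definition pair_product :: "(4 \<Rightarrow> real) \<Rightarrow> 4 uprod \<Rightarrow> real"
  is "\<lambda>f (a, b). f a * f b"
  by (auto simp: eq_upair_def mult.commute)

definition xi ::
  "(4 \<Rightarrow> real^2) \<Rightarrow> (4 \<Rightarrow> real^2 \<Rightarrow> real) \<Rightarrow> 4 uprod \<Rightarrow> real^2 \<Rightarrow> real" where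
  "xi v lam ij x =
     (\<Sum>ab\<in>I_pairs. quad_coeff v ij ab * pair_product (\<lambda>i. lam i x) ab)"

text \<open>The matrix \<open>v w\<^sup>T\<close> of two column vectors.\<close>

definition outer :: "real^2 \<Rightarrow> real^2 \<Rightarrow> real^2^2" where
  "outer v w = (columnvector v :: real^1^2) ** transpose (columnvector w :: real^1^2)"

end

theory Submission
  imports Defs
begin

text \<open>
  The three identities are one identity for three choices of a symmetric biaffine map \<open>B\<close>: the
  sum of the terms \<open>\<xi>\<^sub>i\<^sub>i B(v\<^sub>i, v\<^sub>i)\<close> and \<open>2 \<xi>\<^sub>i\<^sub>,\<^sub>i\<^sub>+\<^sub>1 B(v\<^sub>i, v\<^sub>i\<^sub>+\<^sub>1)\<close> is \<open>B(x, x)\<close>. The choices are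
  the constant 1, the midpoint, and half of \<open>x y\<^sup>T + y x\<^sup>T\<close>.

  By exactness on functions of degree at most one, \<open>x\<close> is the affine combination of the vertices
  with weights \<open>\<lambda>\<^sub>i\<close>. Hence \<open>B(x, x)\<close> is the double sum of the terms \<open>\<lambda>\<^sub>i \<lambda>\<^sub>j B(v\<^sub>i, v\<^sub>j)\<close>, in
  which only the diagonal terms \<open>2 \<lambda>\<^sub>1 \<lambda>\<^sub>3 B(v\<^sub>1, v\<^sub>3)\<close> and \<open>2 \<lambda>\<^sub>2 \<lambda>\<^sub>4 B(v\<^sub>2, v\<^sub>4)\<close> do not belong to
  a vertex or an edge. The functions \<open>\<xi>\<^sub>i\<^sub>j\<close> redistribute these two (\<open>xi_eq\<close>), and so it is enough
  that the coefficients \<open>c\<^sup>i\<^sup>j\<^sub>1\<^sub>3\<close> express \<open>2 B(v\<^sub>1, v\<^sub>3)\<close> by values of \<open>B\<close> on vertex and edge pairs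
  (\<open>boundary_sum_coeff_13\<close>); the cyclic relabeling then settles the other diagonal.

  The coordinates that define \<open>c\<^sup>i\<^sup>j\<^sub>1\<^sub>3\<close> conceal an affinely invariant meaning. The diagonals cross
  at a point \<open>q = s v\<^sub>2 + t v\<^sub>4 = a v\<^sub>1 + b v\<^sub>3\<close> with \<open>s + t = a + b = 1\<close>; the coefficients of the
  edges at \<open>v\<^sub>2\<close> and at \<open>v\<^sub>4\<close> are \<open>s\<close> and \<open>t\<close>, and those of the vertices \<open>v\<^sub>1\<close> and \<open>v\<^sub>3\<close> are
  \<open>-2a\<close> and \<open>-2b\<close> (\<open>coeff_13_cases\<close>). In these terms the expression for \<open>2 B(v\<^sub>1, v\<^sub>3)\<close> follows
  by expanding \<open>B(q, v\<^sub>1) + B(q, v\<^sub>3)\<close> along both diagonals.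
\<close>

section \<open>Symmetric biaffine maps\<close>

definition symmetric_biaffine :: "('a::real_vector \<Rightarrow> 'a \<Rightarrow> 'b::real_vector) \<Rightarrow> bool" where
  "symmetric_biaffine B \<longleftrightarrow>
     (\<forall>x y. B x y = B y x) \<and> (\<forall>y. \<exists>f c. linear f \<and> (\<forall>x. B x y = f x + c))"

lemma symmetric_biaffine_commute: "symmetric_biaffine B \<Longrightarrow> B x y = B y x"
  unfolding symmetric_biaffine_def by blast

lemma symmetric_biaffine_sum_left:
  assumes "symmetric_biaffine B" and "sum w I = 1"
  shows "B (\<Sum>i\<in>I. w i *\<^sub>R p i) y = (\<Sum>i\<in>I. w i *\<^sub>R B (p i) y)"
proof -
  obtain f c where f: "linear f" and B: "\<And>x. B x y = f x + c"
    using assms(1) unfolding symmetric_biaffine_def by meson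
  have "(\<Sum>i\<in>I. w i *\<^sub>R B (p i) y) = (\<Sum>i\<in>I. w i *\<^sub>R f (p i)) + sum w I *\<^sub>R c"
    by (simp add: B scaleR_right_distrib sum.distrib scaleR_left.sum)
  then show ?thesis
    by (simp add: B assms(2) linear_sum[OF f] linear_cmul[OF f])
qed

lemma symmetric_biaffine_sum_right:
  assumes "symmetric_biaffine B" and "sum w I = 1"
  shows "B y (\<Sum>i\<in>I. w i *\<^sub>R p i) = (\<Sum>i\<in>I. w i *\<^sub>R B y (p i))"
  unfolding symmetric_biaffine_commute[OF assms(1), of y]
  by (rule symmetric_biaffine_sum_left[OF assms])

lemma symmetric_biaffine_combine:
  assumes "symmetric_biaffine B" and "a + b = 1"
  shows "B (a *\<^sub>R p + b *\<^sub>R q) y = a *\<^sub>R B p y + b *\<^sub>R B q y"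
  using symmetric_biaffine_sum_left[where B=B and I=UNIV and y=y and
      w="\<lambda>k. if k then a else b" and p="\<lambda>k. if k then p else q"] assms
  by (simp add: UNIV_bool add.commute)

lemma outer_nth: "outer x y $ i $ j = x $ i * y $ j"
  by (simp add: outer_def matrix_matrix_mult_def columnvector_def transpose_def)

lemma symmetric_biaffine_const: "symmetric_biaffine (\<lambda>_ _. c)"
  unfolding symmetric_biaffine_def
  by (auto intro!: exI[of _ "\<lambda>_. 0"] exI[of _ c] linear_zero)

lemma symmetric_biaffine_midpoint: "symmetric_biaffine midpoint"
  unfolding symmetric_biaffine_def
proof (intro conjI allI)
  fix y :: 'a
  show "\<exists>f c. linear f \<and> (\<forall>x. midpoint x y = f x + c)"
    by (intro exI[of _ "\<lambda>x. (1/2) *\<^sub>R x"] exI[of _ "(1/2) *\<^sub>R y"])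
      (simp add: midpoint_def linear_iff algebra_simps)
qed (rule midpoint_sym)

lemma symmetric_biaffine_outer:
  "symmetric_biaffine (\<lambda>x y. (1/2) *\<^sub>R (outer x y + outer y x))"
  unfolding symmetric_biaffine_def
proof (intro conjI allI)
  fix y :: "real^2"
  show "\<exists>f c. linear f \<and> (\<forall>x. (1/2) *\<^sub>R (outer x y + outer y x) = f x + c)"
    by (intro exI[of _ "\<lambda>x. (1/2) *\<^sub>R (outer x y + outer y x)"] exI[of _ 0])
      (simp add: linear_iff vec_eq_iff outer_nth algebra_simps)
qed (simp add: add.commute)

section \<open>Placing a diagonal on the horizontal axis\<close>

lemma det_vector_2: "det (vector [p, q] :: real^2^2) = p$1 * q$2 - p$2 * q$1"
  by (simp add: det_2)

lemma rigid_motion_preserves_combine: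
  assumes "rigid_motion \<phi>" and "a + b = 1"
  shows "\<phi> (a *\<^sub>R p + b *\<^sub>R q) = a *\<^sub>R \<phi> p + b *\<^sub>R \<phi> q"
proof -
  obtain A t where \<phi>: "\<phi> = (\<lambda>x. A *v x + t)"
    using assms(1) unfolding rigid_motion_def by blast
  have "a *\<^sub>R \<phi> p + b *\<^sub>R \<phi> q = a *\<^sub>R (A *v p) + b *\<^sub>R (A *v q) + (a + b) *\<^sub>R t"
    by (simp add: \<phi> algebra_simps)
  then show ?thesis
    by (simp add: \<phi> assms(2) matrix_vector_right_distrib matrix_vector_mult_scaleR)
qed

lemma rigid_motion_inj:
  assumes "rigid_motion \<phi>"
  shows "inj \<phi>"
proof -
  obtain A t where "rotation_matrix A" and \<phi>: "\<phi> = (\<lambda>x. A *v x + t)"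
    using assms unfolding rigid_motion_def by blast
  then have "transpose A ** A = mat 1"
    by (simp add: rotation_matrix_def orthogonal_matrix)
  then have "transpose A *v (\<phi> x - t) = x" for x
    by (simp add: \<phi> matrix_vector_mul_assoc)
  then show ?thesis
    by (rule inj_on_inverseI)
qed

text \<open>
  The coefficients are read off from a motion picked by a choice operator, so they mean something
  only once such a motion is known to exist. The rotation takes the direction of the diagonal to
  the horizontal one, after the midpoint of the diagonal has been moved to the origin; the second
  coordinate of an image is then the signed distance from the diagonal.
\<close>

lemma places_13_exists:
  fixes v :: "4 \<Rightarrow> real^2"
  assumes right: "det (vector [v 3 - v 1, v 2 - v 1] :: real^2^2) < 0"
    and left: "det (vector [v 3 - v 1, v 4 - v 1] :: real^2^2) > 0"
  shows "\<exists>\<phi>. places_13 v \<phi>"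
proof -
  define d where "d = v 3 - v 1"
  define r where "r = norm d"
  have "d \<noteq> 0" using left by (auto simp: d_def det_vector_2)
  then have r: "r > 0" by (simp add: r_def)
  have r2: "r * r = d$1 * d$1 + d$2 * d$2"
    using dot_square_norm[of d] by (simp add: r_def inner_vec_def sum_2 power2_eq_square)
  define A :: "real^2^2" where
    "A = vector [vector [d$1 / r, d$2 / r], vector [- d$2 / r, d$1 / r]]"
  have unit: "d$1 * d$1 / (r * r) + d$2 * d$2 / (r * r) = 1"
    using r by (simp add: r2[symmetric] add_divide_distrib[symmetric])
  have rot: "rotation_matrix A"
    using unit
    by (simp add: rotation_matrix_def orthogonal_matrix A_def det_2 vec_eq_iff forall_2
        matrix_matrix_mult_def transpose_def sum_2 mat_def add.commute)
  define \<phi> where "\<phi> = (\<lambda>x. A *v x + - (A *v midpoint (v 1) (v 3)))"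
  have rigid: "rigid_motion \<phi>"
    unfolding rigid_motion_def \<phi>_def using rot by blast
  have \<phi>: "\<phi> x = A *v (x - midpoint (v 1) (v 3))" for x
    by (simp add: \<phi>_def matrix_vector_mult_diff_distrib)
  have coords: "(A *v y)$1 = (d$1 * y$1 + d$2 * y$2) / r"
    "(A *v y)$2 = (d$1 * y$2 - d$2 * y$1) / r" for y
    by (simp_all add: A_def matrix_vector_mult_def sum_2 diff_divide_distrib add_divide_distrib)
  have Ad: "A *v d = vector [r, 0]"
    using r by (simp add: vec_eq_iff forall_2 coords r2[symmetric])
  have half: "v 3 - midpoint (v 1) (v 3) = (1/2) *\<^sub>R d"
      "v 1 - midpoint (v 1) (v 3) = (- 1/2) *\<^sub>R d"
    by (simp_all add: d_def midpoint_def vec_eq_iff algebra_simps)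
  have w1: "\<phi> (v 1) = vector [- (r/2), 0]" and w3: "\<phi> (v 3) = vector [r/2, 0]"
    unfolding \<phi> half matrix_vector_mult_scaleR Ad by (simp_all add: vec_eq_iff forall_2)
  have y: "\<phi> x $ 2 = det (vector [d, x - v 1] :: real^2^2) / r" for x
  proof -
    have shift: "x - midpoint (v 1) (v 3) = (x - v 1) - (1/2) *\<^sub>R d"
      by (simp add: d_def midpoint_def vec_eq_iff algebra_simps)
    show ?thesis
      unfolding \<phi> shift by (simp add: coords det_vector_2) (simp add: algebra_simps)
  qed
  have "places_13 v \<phi>"
    unfolding places_13_def
  proof (intro conjI rigid exI[of _ "r/2"])
    show "\<phi> (v 2) $ 2 < 0" using right r by (simp add: y d_def divide_neg_pos)
    show "\<phi> (v 4) $ 2 > 0" using left r by (simp add: y d_def)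
  qed (use r w1 w3 in auto)
  then show ?thesis by blast
qed

section \<open>The coefficients of a diagonal\<close>

text \<open>
  The part of \<^const>\<open>convex_quadrilateral\<close> that does not mention the region, so that it can be
  transported along the cyclic relabeling of the vertices.
\<close>

definition strictly_convex_ccw :: "(4 \<Rightarrow> real^2) \<Rightarrow> bool" where
  "strictly_convex_ccw v \<longleftrightarrow>
     (\<forall>i j. j \<noteq> i \<and> j \<noteq> i + 1 \<longrightarrow>
        det (vector [v (i + 1) - v i, v j - v i] :: real^2^2) > 0)"

lemma strictly_convex_ccw_shift:
  assumes "strictly_convex_ccw v"
  shows "strictly_convex_ccw (\<lambda>i. v (i + 1))"
  unfolding strictly_convex_ccw_def
proof (intro allI impI)
  fix i j :: 4 assume "j \<noteq> i \<and> j \<noteq> i + 1"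
  then have "j + 1 \<noteq> i + 1 \<and> j + 1 \<noteq> (i + 1) + 1" by (simp only: add_right_cancel simp_thms)
  then show "det (vector [v (i + 1 + 1) - v (i + 1), v (j + 1) - v (i + 1)] :: real^2^2) > 0"
    using assms unfolding strictly_convex_ccw_def by blast
qed

text \<open>
  The edge coefficients \<open>s\<close>, \<open>t\<close> are the weights of the point of the diagonal \<open>24\<close> at height \<open>0\<close>
  after the motion, which is where the diagonals cross; \<open>\<tau>\<close> is the position of this point on the
  diagonal \<open>13\<close>, which runs from \<open>-1\<close> to \<open>1\<close>. Affine combinations are pulled back along
  the motion because it is affine and injective.
\<close>

lemma coeff_13_cases:
  fixes v :: "4 \<Rightarrow> real^2"
  assumes "strictly_convex_ccw v"
  obtains s t a b where "s + t = 1" and "a + b = 1"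
    and "s *\<^sub>R v 2 + t *\<^sub>R v 4 = a *\<^sub>R v 1 + b *\<^sub>R v 3"
    and "coeff_13 v (Upair 1 1) = - 2 * a" and "coeff_13 v (Upair 3 3) = - 2 * b"
    and "coeff_13 v (Upair 2 2) = 0" and "coeff_13 v (Upair 4 4) = 0"
    and "coeff_13 v (Upair 1 2) = s" and "coeff_13 v (Upair 2 3) = s"
    and "coeff_13 v (Upair 3 4) = t" and "coeff_13 v (Upair 4 1) = t"
proof -
  have "det (vector [v 2 - v 1, v 3 - v 1] :: real^2^2) > 0"
    "det (vector [v 4 - v 3, v 1 - v 3] :: real^2^2) > 0"
    using assms[unfolded strictly_convex_ccw_def, rule_format, of 3 1]
      assms[unfolded strictly_convex_ccw_def, rule_format, of 1 3] by simp_all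
  then have "\<exists>\<phi>. places_13 v \<phi>"
    by (intro places_13_exists) (simp_all add: det_vector_2 algebra_simps)
  define \<phi> where "\<phi> = (SOME \<phi>. places_13 v \<phi>)"
  have places: "places_13 v \<phi>"
    unfolding \<phi>_def using \<open>\<exists>\<phi>. places_13 v \<phi>\<close> by (rule someI_ex)
  then obtain l where l: "l > 0" and w1: "\<phi> (v 1) = vector [- l, 0]"
    and w3: "\<phi> (v 3) = vector [l, 0]" and rigid: "rigid_motion \<phi>"
    and y2: "\<phi> (v 2) $ 2 < 0" and y4: "\<phi> (v 4) $ 2 > 0"
    unfolding places_13_def by blast
  define w where "w k = \<phi> (v k)" for k
  define s where "s = w 4 $ 2 / (w 4 $ 2 - w 2 $ 2)"
  define t where "t = w 2 $ 2 / (w 2 $ 2 - w 4 $ 2)"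
  define \<tau> where "\<tau> = (s * w 2 $ 1 + t * w 4 $ 1) / l"
  define a where "a = (1 - \<tau>) / 2"
  define b where "b = (1 + \<tau>) / 2"
  have st: "s + t = 1"
    using y2 y4 by (simp add: s_def t_def w_def divide_simps) (simp add: algebra_simps)
  have ab: "a + b = 1" by (simp add: a_def b_def field_simps)
  have y0: "s * w 2 $ 2 + t * w 4 $ 2 = 0"
    using y2 y4 by (simp add: s_def t_def w_def divide_simps) (simp add: algebra_simps)
  have "s *\<^sub>R w 2 + t *\<^sub>R w 4 = a *\<^sub>R w 1 + b *\<^sub>R w 3"
    using l y0
    by (simp add: vec_eq_iff forall_2 w1[folded w_def] w3[folded w_def] a_def b_def \<tau>_def)
       (simp add: field_simps)
  then have "\<phi> (s *\<^sub>R v 2 + t *\<^sub>R v 4) = \<phi> (a *\<^sub>R v 1 + b *\<^sub>R v 3)"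
    by (simp add: rigid_motion_preserves_combine rigid st ab w_def)
  then have q: "s *\<^sub>R v 2 + t *\<^sub>R v 4 = a *\<^sub>R v 1 + b *\<^sub>R v 3"
    using rigid_motion_inj[OF rigid] by (simp add: inj_eq)
  have c: "coeff_13 v ij =
      (if ij \<in> {Upair 2 2, Upair 4 4} then 0
       else if ij \<in> {Upair 1 2, Upair 2 3} then s
       else if ij \<in> {Upair 3 4, Upair 1 4} then t
       else if ij = Upair 1 1 then \<tau> - 1
       else if ij = Upair 3 3 then - \<tau> - 1
       else 0)" for ij
    unfolding coeff_13_def Let_def \<phi>_def[symmetric]
    by (simp add: s_def t_def \<tau>_def w_def w3)
  show thesis
    by (rule that[OF st ab q]) (simp_all add: c a_def b_def field_simps)
qed

section \<open>Reducing the diagonal pairs to the boundary\<close>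

definition boundary_sum ::
  "(4 \<Rightarrow> real^2) \<Rightarrow> (real^2 \<Rightarrow> real^2 \<Rightarrow> 'b::real_vector) \<Rightarrow> (4 uprod \<Rightarrow> real) \<Rightarrow> 'b" where
  "boundary_sum v B c =
     (\<Sum>i\<in>UNIV. c (Upair i i) *\<^sub>R B (v i) (v i)) +
     (\<Sum>i\<in>UNIV. (2 * c (Upair i (i + 1))) *\<^sub>R B (v i) (v (i + 1)))"

lemma succ_4: "(1::4) + 1 = 2" "(2::4) + 1 = 3" "(3::4) + 1 = 4" "(4::4) + 1 = 1"
  by simp_all

text \<open>
  Evaluating \<open>B\<close> at the crossing point \<open>q\<close> of the diagonals and at \<open>v 1\<close>, and likewise at \<open>q\<close> and
  \<open>v 3\<close>, along both diagonals expresses each value by boundary pairs on one side, and by the pairs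
  \<open>11\<close>, \<open>13\<close> and \<open>33\<close> on the other. In the sum of the two equations \<open>B (v 1) (v 3)\<close> has weight
  \<open>a + b = 1\<close>, so that the equation can be solved for it; the solution has the coefficients
  \<open>c\<^sup>i\<^sup>j\<^sub>1\<^sub>3\<close>.
\<close>

lemma boundary_sum_coeff_13:
  assumes "strictly_convex_ccw v" and B: "symmetric_biaffine B"
  shows "boundary_sum v B (coeff_13 v) = 2 *\<^sub>R B (v 1) (v 3)"
proof -
  obtain s t a b where st: "s + t = 1" and ab: "a + b = 1"
    and q: "s *\<^sub>R v 2 + t *\<^sub>R v 4 = a *\<^sub>R v 1 + b *\<^sub>R v 3"
    and c: "coeff_13 v (Upair 1 1) = - 2 * a" "coeff_13 v (Upair 3 3) = - 2 * b"
      "coeff_13 v (Upair 2 2) = 0" "coeff_13 v (Upair 4 4) = 0"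
      "coeff_13 v (Upair 1 2) = s" "coeff_13 v (Upair 2 3) = s"
      "coeff_13 v (Upair 3 4) = t" "coeff_13 v (Upair 4 1) = t"
    using coeff_13_cases[OF assms(1)] by metis
  have sym: "B (v 3) (v 1) = B (v 1) (v 3)" "B (v 2) (v 1) = B (v 1) (v 2)"
    "B (v 4) (v 3) = B (v 3) (v 4)"
    using symmetric_biaffine_commute[OF B] by blast+
  have e1: "s *\<^sub>R B (v 1) (v 2) + t *\<^sub>R B (v 4) (v 1) = a *\<^sub>R B (v 1) (v 1) + b *\<^sub>R B (v 1) (v 3)"
    using arg_cong[OF q, of "\<lambda>p. B p (v 1)"]
    by (simp only: symmetric_biaffine_combine[OF B st] symmetric_biaffine_combine[OF B ab] sym)
  have e3: "s *\<^sub>R B (v 2) (v 3) + t *\<^sub>R B (v 3) (v 4) = a *\<^sub>R B (v 1) (v 3) + b *\<^sub>R B (v 3) (v 3)"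
    using arg_cong[OF q, of "\<lambda>p. B p (v 3)"]
    by (simp only: symmetric_biaffine_combine[OF B st] symmetric_biaffine_combine[OF B ab] sym)
  have "boundary_sum v B (coeff_13 v) =
      2 *\<^sub>R ((s *\<^sub>R B (v 1) (v 2) + t *\<^sub>R B (v 4) (v 1))
            + (s *\<^sub>R B (v 2) (v 3) + t *\<^sub>R B (v 3) (v 4))
            - a *\<^sub>R B (v 1) (v 1) - b *\<^sub>R B (v 3) (v 3))"
    by (simp only: boundary_sum_def sum_4 succ_4 c) (simp add: algebra_simps)
  also have "\<dots> = 2 *\<^sub>R ((a + b) *\<^sub>R B (v 1) (v 3))"
    unfolding e1 e3 by (simp add: algebra_simps)
  finally show ?thesis by (simp add: ab)
qed

text \<open>
  Relabeling the vertices amounts to pulling back the coefficients; this turns the statement for the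
  diagonal \<open>13\<close> into that for \<open>24\<close>.
\<close>

lemma boundary_sum_shift:
  "boundary_sum (\<lambda>i. v (i + 1)) B c = boundary_sum v B (\<lambda>ij. c (map_uprod (\<lambda>i. i - 1) ij))"
proof -
  have bij: "bij_betw (\<lambda>i::4. i + 1) UNIV UNIV"
    by (rule bij_betwI[where g="\<lambda>i. i - 1"]) auto
  show ?thesis
    using sum.reindex_bij_betw[OF bij, of "\<lambda>i. c (Upair (i - 1) (i - 1)) *\<^sub>R B (v i) (v i)"]
      sum.reindex_bij_betw[OF bij, of "\<lambda>i. (2 * c (Upair (i - 1) i)) *\<^sub>R B (v i) (v (i + 1))"]
    by (simp add: boundary_sum_def)
qed

lemma boundary_sum_coeff_24:
  assumes "strictly_convex_ccw v" and "symmetric_biaffine B"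
  shows "boundary_sum v B (coeff_24 v) = 2 *\<^sub>R B (v 2) (v 4)"
  using boundary_sum_coeff_13[OF strictly_convex_ccw_shift[OF assms(1)] assms(2)]
  by (simp add: boundary_sum_shift coeff_24_def[abs_def])

section \<open>The quadratic functions on the quadrilateral\<close>

lemma I_pairs_eq:
  "I_pairs = {Upair 1 1, Upair 2 2, Upair 3 3, Upair 4 4, Upair 1 2, Upair 2 3, Upair 3 4,
     Upair 1 4, Upair 1 3, Upair 2 4}"
proof -
  have "Upair a b \<in> {Upair 1 1, Upair 2 2, Upair 3 3, Upair 4 4, Upair 1 2, Upair 2 3,
     Upair 3 4, Upair 1 4, Upair 1 3, Upair 2 4}" for a b :: 4
    using exhaust_4[of a] exhaust_4[of b] by (elim disjE) simp_all
  then show ?thesis unfolding I_pairs_def by blast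
qed

lemma pair_product_Upair: "pair_product f (Upair a b) = f a * f b"
  by transfer simp

text \<open>
  Each product on a vertex or an edge pair is kept, and the products of the two diagonal pairs are
  distributed over all the boundary pairs.
\<close>

lemma xi_eq:
  assumes "ij \<in> V_pairs \<union> E_pairs"
  shows "xi v lam ij x = pair_product (\<lambda>i. lam i x) ij
     + lam 1 x * lam 3 x * coeff_13 v ij + lam 2 x * lam 4 x * coeff_24 v ij"
proof -
  have "sum f I_pairs = sum f (V_pairs \<union> E_pairs) + f (Upair 1 3) + f (Upair 2 4)"
    for f :: "4 uprod \<Rightarrow> real"
    by (simp add: I_pairs_eq V_pairs_def E_pairs_def)
  moreover have "(\<Sum>ab\<in>V_pairs \<union> E_pairs. quad_coeff v ij ab * pair_product (\<lambda>i. lam i x) ab)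
      = (\<Sum>ab\<in>V_pairs \<union> E_pairs. if ij = ab then pair_product (\<lambda>i. lam i x) ab else 0)"
    by (rule sum.cong) (auto simp: quad_coeff_def)
  moreover have "\<dots> = pair_product (\<lambda>i. lam i x) ij"
    using assms by (subst sum.delta') (simp_all add: V_pairs_def E_pairs_def)
  moreover have "Upair 1 3 \<notin> V_pairs \<union> E_pairs" "Upair 2 4 \<notin> V_pairs \<union> E_pairs"
    by (simp_all add: V_pairs_def E_pairs_def)
  ultimately show ?thesis
    by (simp add: xi_def quad_coeff_def pair_product_Upair mult.commute)
qed

lemma boundary_sum_cong:
  assumes "\<And>ij. ij \<in> V_pairs \<union> E_pairs \<Longrightarrow> c ij = c' ij"
  shows "boundary_sum v B c = boundary_sum v B c'"
proof -
  have "Upair i i \<in> V_pairs \<union> E_pairs" "Upair i (i + 1) \<in> V_pairs \<union> E_pairs" for i :: 4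
    using exhaust_4[of i] by (auto simp: V_pairs_def E_pairs_def)
  then show ?thesis by (simp add: boundary_sum_def assms)
qed

lemma boundary_sum_linear:
  "boundary_sum v B (\<lambda>ij. c ij + p * d ij + q * e ij) =
     boundary_sum v B c + p *\<^sub>R boundary_sum v B d + q *\<^sub>R boundary_sum v B e"
  by (simp add: boundary_sum_def sum.distrib scaleR_sum_right algebra_simps)

lemma barycentric_coordinates_sum:
  assumes "barycentric_coordinates \<Omega> v lam" and "x \<in> \<Omega>"
  shows "(\<Sum>i\<in>UNIV. lam i x) = 1"
proof -
  have "degree_le_1 (\<lambda>_. 1)"
    unfolding degree_le_1_def by (intro exI[of _ "\<lambda>_. 0"] exI[of _ 1]) (simp add: linear_zero)
  then show ?thesis using assms unfolding barycentric_coordinates_def by fastforce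
qed

lemma barycentric_coordinates_combination:
  assumes "barycentric_coordinates \<Omega> v lam" and "x \<in> \<Omega>"
  shows "(\<Sum>i\<in>UNIV. lam i x *\<^sub>R v i) = x"
proof -
  have "degree_le_1 (\<lambda>y. y $ k)" for k
    unfolding degree_le_1_def
    by (intro exI[of _ "\<lambda>y. y $ k"] exI[of _ 0]) (simp add: linear_iff)
  then have "x $ k = (\<Sum>i\<in>UNIV. v i $ k * lam i x)" for k
    using assms unfolding barycentric_coordinates_def by blast
  then show ?thesis by (simp add: vec_eq_iff mult.commute)
qed

text \<open>
  The expansion of \<open>B x x\<close> over ordered index pairs contains every edge and every diagonal twice,
  whence the factors \<open>2\<close>.
\<close>

lemma boundary_sum_xi:
  assumes "strictly_convex_ccw v" and "barycentric_coordinates \<Omega> v lam"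
    and B: "symmetric_biaffine B" and "x \<in> \<Omega>"
  shows "boundary_sum v B (\<lambda>ij. xi v lam ij x) = B x x"
proof -
  define l where "l i = lam i x" for i
  define P where "P i j = (l i * l j) *\<^sub>R B (v i) (v j)" for i j
  have P_commute: "P i j = P j i" for i j
    by (simp add: P_def symmetric_biaffine_commute[OF B, of "v j"] mult.commute)
  have l: "sum l UNIV = 1" "(\<Sum>i\<in>UNIV. l i *\<^sub>R v i) = x"
    using barycentric_coordinates_sum barycentric_coordinates_combination assms(2,4)
    unfolding l_def by blast+
  have "B x x = (\<Sum>i\<in>UNIV. l i *\<^sub>R B (v i) x)"
    using symmetric_biaffine_sum_left[OF B l(1), of v x] by (simp add: l(2))
  also have "\<dots> = (\<Sum>i\<in>UNIV. \<Sum>j\<in>UNIV. P i j)"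
    using symmetric_biaffine_sum_right[OF B l(1), of _ v]
    by (simp add: l(2) P_def scaleR_sum_right)
  also have "\<dots> = ((\<Sum>i\<in>UNIV. P i i) + (\<Sum>i\<in>UNIV. 2 *\<^sub>R P i (i + 1)))
      + 2 *\<^sub>R P 1 3 + 2 *\<^sub>R P 2 4"
    by (simp only: sum_4 succ_4) (simp add: P_commute[of 2 1] P_commute[of 3 1] P_commute[of 3 2]
      P_commute[of 4 1] P_commute[of 4 2] P_commute[of 4 3] scaleR_2)
  also have "(\<Sum>i\<in>UNIV. P i i) + (\<Sum>i\<in>UNIV. 2 *\<^sub>R P i (i + 1)) = boundary_sum v B (pair_product l)"
    by (simp add: boundary_sum_def P_def pair_product_Upair mult.assoc)
  also have "\<dots> + 2 *\<^sub>R P 1 3 + 2 *\<^sub>R P 2 4 =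
      boundary_sum v B (\<lambda>ij. pair_product l ij + l 1 * l 3 * coeff_13 v ij + l 2 * l 4 * coeff_24 v ij)"
    unfolding boundary_sum_linear boundary_sum_coeff_13[OF assms(1) B]
      boundary_sum_coeff_24[OF assms(1) B]
    by (simp add: P_def mult.commute)
  also have "\<dots> = boundary_sum v B (\<lambda>ij. xi v lam ij x)"
    by (rule boundary_sum_cong) (simp add: xi_eq l_def[abs_def])
  finally show ?thesis by simp
qed

theorem theorem4p4:
  fixes \<Omega> :: "(real^2) set"
    and v :: "4 \<Rightarrow> real^2"
    and lam :: "4 \<Rightarrow> real^2 \<Rightarrow> real"
  assumes "convex_quadrilateral \<Omega> v"
    and "barycentric_coordinates \<Omega> v lam"
  shows "\<forall>x\<in>\<Omega>.
    (\<Sum>i\<in>UNIV. xi v lam (Upair i i) x) +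
      (\<Sum>i\<in>UNIV. 2 * xi v lam (Upair i (i + 1)) x) = 1 \<and>
    (\<Sum>i\<in>UNIV. xi v lam (Upair i i) x *\<^sub>R midpoint (v i) (v i)) +
      (\<Sum>i\<in>UNIV. (2 * xi v lam (Upair i (i + 1)) x) *\<^sub>R midpoint (v i) (v (i + 1))) = x \<and>
    (\<Sum>i\<in>UNIV. xi v lam (Upair i i) x *\<^sub>R outer (v i) (v i)) +
      (\<Sum>i\<in>UNIV. xi v lam (Upair i (i + 1)) x *\<^sub>R
         (outer (v i) (v (i + 1)) + outer (v (i + 1)) (v i))) = outer x x"
proof
  fix x assume "x \<in> \<Omega>"
  have "strictly_convex_ccw v"
    using assms(1) unfolding convex_quadrilateral_def strictly_convex_ccw_def by blast
  note exact = boundary_sum_xi[OF this assms(2) _ \<open>x \<in> \<Omega>\<close>, unfolded boundary_sum_def]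
  have halves: "(2 * c) *\<^sub>R ((1/2) *\<^sub>R M) = c *\<^sub>R M" "(1/2) *\<^sub>R (M + M) = M"
    for c and M :: "real^2^2"
    by (simp_all only: scaleR_half_double) simp
  show "(\<Sum>i\<in>UNIV. xi v lam (Upair i i) x) +
      (\<Sum>i\<in>UNIV. 2 * xi v lam (Upair i (i + 1)) x) = 1 \<and>
    (\<Sum>i\<in>UNIV. xi v lam (Upair i i) x *\<^sub>R midpoint (v i) (v i)) +
      (\<Sum>i\<in>UNIV. (2 * xi v lam (Upair i (i + 1)) x) *\<^sub>R midpoint (v i) (v (i + 1))) = x \<and>
    (\<Sum>i\<in>UNIV. xi v lam (Upair i i) x *\<^sub>R outer (v i) (v i)) +
      (\<Sum>i\<in>UNIV. xi v lam (Upair i (i + 1)) x *\<^sub>R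
         (outer (v i) (v (i + 1)) + outer (v (i + 1)) (v i))) = outer x x"
    using exact[OF symmetric_biaffine_const[of "1::real"]]
      exact[OF symmetric_biaffine_midpoint] exact[OF symmetric_biaffine_outer]
    by (simp only: halves real_scaleR_def mult_1_right midpoint_idem simp_thms)
qed

end
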